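(* Assume (1) there exists at least one contractive policy; and (2) $U$ is a metric space, for all $i,j$ the functions $A_{ij}(\cdot)$ and $b(i,\cdot)$ are continuous on $U(i)$, and for each state $i$ the sets $\{u\in U(i)\mid b(i,u)+\sum_{j=1}^n A_{ij}(u)J(j)\le\lambda\}$ are compact subsets of $U$ for all $\lambda\in\mathbb{R}$ and all $J\in\mathbb{R}^n_+$. Let $\hat J$ be the optimal cost function over contractive policies, $\hat J(i)=\inf_{\mu:\ \text{contractive}}J_\mu(i)$, $i=1,\ldots,n$. Then: (a) $\hat J$ is the largest fixed point of $T$ within $\mathbb{R}^n_+$, i.e., $\hat J$ is a fixed point of $T$ that belongs to $\mathbb{R}^n_+$, and if $J'\in\mathbb{R}^n_+$ is another fixed point of $T$, then $J'\le\hat J$. (b) $T^kJ\to\hat J$ as $k\to\infty$ for every $J\in\mathbb{R}^n_+$ with $J\ge\hat J$. (c) Let $\mu$ be a contractive policy. Then $\mu$ is optimal within the class of contractive policies (i.e., $J_\mu=\hat J$) if and only if $T_\mu\hat J=T\hat J$.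
   Context: Notation: $\mathbb{R}^n_+=\{J\mid 0\le J(i)<\infty,\ i=1,\ldots,n\}$ and $\mathcal{E}^n_+=\{J\mid 0\le J(i)\le\infty,\ i=1,\ldots,n\}$. Inequalities, limits, $\limsup$ and $\inf$ of vectors are componentwise. The convention $0\cdot\infty=0$ is used. Affine monotonic model: the state space is $\{1,\ldots,n\}$. There is a control space $U$ and, for each state $i$, a nonempty (possibly infinite) control constraint set $U(i)\subset U$. For all $i,j$ and $u\in U(i)$ there are given real scalars $b(i,u)\ge0$ and $A_{ij}(u)\ge0$. $\mathcal{M}$ is the set of all functions $\mu=(\mu(1),\ldots,\mu(n))$ with $\mu(i)\in U(i)$ for all $i$; each $\mu\in\mathcal{M}$ is identified with the stationary policy $\{\mu,\mu,\ldots\}$. For $\mu\in\mathcal{M}$, $b_\mu\in\mathbb{R}^n$ is the vector with components $b(i,\mu(i))$ and $A_\mu$ is the $n\times n$ matrix with components $A_{ij}(\mu(i))$. The mappings $T_\mu,T:\mathcal{E}^n_+\to\mathcal{E}^n_+$ are $$T_\mu J=b_\mu+A_\mu J,\qquad (TJ)(i)=\inf_{u\in U(i)}\Big[b(i,u)+\sum_{j=1}^nA_{ij}(u)J(j)\Big],\quad i=1,\ldots,n.$$ A vector $\bar J\in\mathbb{R}^n_+$ is fixed. The cost function of a stationary policy $\mu$ is $J_\mu=\limsup_{N\to\infty}T_\mu^N\bar J$. A stationary policy $\mu\in\mathcal{M}$ is called contractive if $A_\mu^N\to0$ as $N\to\infty$ (equivalently, all eigenvalues of $A_\mu$ lie strictly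 inside the unit circle), and noncontractive otherwise. *)

theory Defs
  imports "HOL-Analysis.Analysis"
begin

text \<open>
  States are the elements of a finite type \<open>'n\<close>, and the control space is a type \<open>'u\<close>.
  The extended nonnegative vectors are modelled as \<open>ennreal ^ 'n\<close>, so that \<open>0 * \<infinity> = 0\<close>,
  infima and upper limits are taken in \<open>[0, \<infinity>]\<close>, and the order and the topology on vectors are
  componentwise. The model data are the control constraint sets \<open>U\<close>, the costs \<open>b i u\<close>, the
  coefficients \<open>A i j u\<close> (only their values for \<open>u \<in> U i\<close> matter) and the initial vector
  \<open>Jbar\<close>.
\<close>

definition finite_vecs :: "(ennreal ^ 'n::finite) set" where
  "finite_vecs = {J. \<forall>i. J $ i < \<infinity>}"

definition policies :: "('n::finite \<Rightarrow> 'u set) \<Rightarrow> ('n \<Rightarrow> 'u) set" where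
  "policies U = {\<mu>. \<forall>i. \<mu> i \<in> U i}"

definition b_pol :: "('n::finite \<Rightarrow> 'u \<Rightarrow> real) \<Rightarrow> ('n \<Rightarrow> 'u) \<Rightarrow> real ^ 'n" where
  "b_pol b \<mu> = (\<chi> i. b i (\<mu> i))"

definition A_pol :: "('n::finite \<Rightarrow> 'n \<Rightarrow> 'u \<Rightarrow> real) \<Rightarrow> ('n \<Rightarrow> 'u) \<Rightarrow> real ^ 'n ^ 'n" where
  "A_pol A \<mu> = (\<chi> i j. A i j (\<mu> i))"

text \<open>
  \<open>ennreal\<close> maps negative reals to \<open>0\<close>; below it is meant to be applied to nonnegative
  data only.
\<close>

definition T_pol ::
  "('n::finite \<Rightarrow> 'u \<Rightarrow> real) \<Rightarrow> ('n \<Rightarrow> 'n \<Rightarrow> 'u \<Rightarrow> real) \<Rightarrow> ('n \<Rightarrow> 'u)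
    \<Rightarrow> ennreal ^ 'n \<Rightarrow> ennreal ^ 'n" where
  "T_pol b A \<mu> J =
    (\<chi> i. ennreal (b_pol b \<mu> $ i) + (\<Sum>j\<in>UNIV. ennreal (A_pol A \<mu> $ i $ j) * J $ j))"

definition T_opt ::
  "('n::finite \<Rightarrow> 'u set) \<Rightarrow> ('n \<Rightarrow> 'u \<Rightarrow> real) \<Rightarrow> ('n \<Rightarrow> 'n \<Rightarrow> 'u \<Rightarrow> real)
    \<Rightarrow> ennreal ^ 'n \<Rightarrow> ennreal ^ 'n" where
  "T_opt U b A J =
    (\<chi> i. INF u\<in>U i. ennreal (b i u) + (\<Sum>j\<in>UNIV. ennreal (A i j u) * J $ j))"

definition policy_cost ::
  "('n::finite \<Rightarrow> 'u \<Rightarrow> real) \<Rightarrow> ('n \<Rightarrow> 'n \<Rightarrow> 'u \<Rightarrow> real) \<Rightarrow> ennreal ^ 'n \<Rightarrow> ('n \<Rightarrow> 'u)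
    \<Rightarrow> ennreal ^ 'n" where
  "policy_cost b A Jbar \<mu> = (\<chi> i. limsup (\<lambda>N. (T_pol b A \<mu> ^^ N) Jbar $ i))"

text \<open>Matrix powers for the matrix product \<open>**\<close>.\<close>

primrec matrix_power :: "real ^ 'n ^ 'n::finite \<Rightarrow> nat \<Rightarrow> real ^ 'n ^ 'n" where
  "matrix_power M 0 = mat 1"
| "matrix_power M (Suc N) = M ** matrix_power M N"

definition contractive_policies ::
  "('n::finite \<Rightarrow> 'u set) \<Rightarrow> ('n \<Rightarrow> 'n \<Rightarrow> 'u \<Rightarrow> real) \<Rightarrow> ('n \<Rightarrow> 'u) set" where
  "contractive_policies U A =
    {\<mu> \<in> policies U. (\<lambda>N. matrix_power (A_pol A \<mu>) N) \<longlonglongrightarrow> 0}"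

definition contractive_opt_cost ::
  "('n::finite \<Rightarrow> 'u set) \<Rightarrow> ('n \<Rightarrow> 'u \<Rightarrow> real) \<Rightarrow> ('n \<Rightarrow> 'n \<Rightarrow> 'u \<Rightarrow> real) \<Rightarrow> ennreal ^ 'n
    \<Rightarrow> ennreal ^ 'n" where
  "contractive_opt_cost U b A Jbar =
    (\<chi> i. INF \<mu>\<in>contractive_policies U A. policy_cost b A Jbar \<mu> $ i)"

end

theory Submission
  imports Defs
begin

text \<open>
  A contractive policy \<open>\<mu>\<close> has a real cost vector, which is the only finite fixed point of \<open>T\<^sub>\<mu>\<close> and
  attracts every finite vector under \<open>T\<^sub>\<mu>\<close> (\<open>contractive_cost\<close>). Together with \<open>T \<le> T\<^sub>\<mu>\<close> and
  monotonicity this gives two of the comparisons at once: every finite \<open>J \<le> T J\<close> satisfies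
  \<open>J \<le> T\<^sub>\<mu>\<^sup>N J\<close> and hence \<open>J \<le> Jhat\<close>, and \<open>T Jhat \<le> T\<^sub>\<mu> J\<^sub>\<mu> = J\<^sub>\<mu>\<close> gives \<open>T Jhat \<le> Jhat\<close>.

  The heart of the matter is \<open>Jhat \<le> T Jhat\<close>: a policy that is greedy with respect to \<open>Jhat\<close> need not
  be contractive, so its cost need not compete in the infimum that defines \<open>Jhat\<close>. The remedy is to
  perturb. A nonnegative matrix \<open>M\<close> has vanishing powers exactly if some finite \<open>w \<ge> 0\<close> satisfies
  \<open>M w + c \<le> w\<close> with \<open>c > 0\<close> in every component. Adding small multiples of such vectors to the
  costs of nearly optimal contractive policies, and taking the minimum of finitely many of the
  results, produces a vector \<open>J\<close> close to \<open>Jhat\<close> with \<open>T J + c \<le> J\<close>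
  (\<open>strict_supersolution_near_Jhat\<close>). The margin \<open>c\<close> has two uses: it pays for the suboptimality of
  an approximately greedy policy, and what is left of it certifies that this policy is contractive.
  Policy improvement then gives \<open>Jhat \<le> T J + c\<close> (\<open>Jhat_le_of_strict_supersolution\<close>), and letting
  the perturbation tend to zero, for one control at a time, yields \<open>Jhat \<le> T Jhat\<close>.

  Once \<open>Jhat\<close> is a fixed point, value iteration from above is squeezed between \<open>Jhat\<close> and the
  iterates of contractive policies. Moreover \<open>T\<^sub>\<mu> Jhat = T Jhat\<close> says that \<open>Jhat\<close> is a finite fixed
  point of \<open>T\<^sub>\<mu>\<close>, which for a contractive \<open>\<mu>\<close> means \<open>Jhat = J\<^sub>\<mu>\<close>.
\<close>

section \<open>Nonnegative matrices with vanishing powers\<close>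

lemma matrix_vector_mult_mono:
  fixes M :: "real^'n^'m" and x y :: "real^'n"
  assumes "0 \<le> M" "x \<le> y"
  shows "M *v x \<le> M *v y"
  using assms
  by (auto simp: less_eq_vec_def matrix_vector_mult_def intro!: sum_mono mult_left_mono)

lemma matrix_power_nonneg:
  fixes M :: "real^'n^'n"
  assumes "0 \<le> M"
  shows "0 \<le> matrix_power M N"
  using assms
  by (induction N) (auto simp: less_eq_vec_def mat_def matrix_matrix_mult_def intro!: sum_nonneg)

lemma matrix_power_Suc_vector: "matrix_power M (Suc N) *v x = M *v (matrix_power M N *v x)"
  by (simp add: matrix_vector_mul_assoc)

lemma matrix_power_vector_tendsto_0:
  fixes M :: "real^'n^'n"
  assumes "(\<lambda>N. matrix_power M N) \<longlonglongrightarrow> 0"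
  shows "(\<lambda>N. matrix_power M N *v x) \<longlonglongrightarrow> 0"
proof (rule vec_tendstoI)
  fix i
  have "(\<lambda>N. \<Sum>j\<in>UNIV. matrix_power M N $ i $ j * x $ j) \<longlonglongrightarrow> (\<Sum>j\<in>UNIV. 0 $ i $ j * x $ j)"
    by (intro tendsto_intros assms)
  then show "(\<lambda>N. (matrix_power M N *v x) $ i) \<longlonglongrightarrow> 0 $ i"
    by (simp add: matrix_vector_mult_def)
qed

lemma affine_iterate:
  fixes M :: "real^'n^'n"
  assumes "x = c + M *v x"
  shows "((\<lambda>y. c + M *v y) ^^ N) y = x + matrix_power M N *v (y - x)"
proof (induction N)
  case (Suc N)
  have "((\<lambda>y. c + M *v y) ^^ Suc N) y = c + M *v (x + matrix_power M N *v (y - x))"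
    by (simp add: Suc)
  also have "\<dots> = (c + M *v x) + matrix_power M (Suc N) *v (y - x)"
    by (simp add: matrix_vector_right_distrib matrix_power_Suc_vector del: matrix_power.simps)
  finally show ?case
    using assms by simp
qed simp

text \<open>
  A vector with \<open>x = M x\<close> equals \<open>M\<^sup>N x\<close> for every \<open>N\<close> and hence vanishes, so \<open>I - M\<close> is injective
  and, the space being finite dimensional, bijective.
\<close>

lemma affine_fixed_point_exists:
  fixes M :: "real^'n^'n"
  assumes lim: "(\<lambda>N. matrix_power M N) \<longlonglongrightarrow> 0"
  shows "\<exists>x. x = c + M *v x"
proof -
  let ?f = "\<lambda>x. x - M *v x"
  have lin: "linear ?f"
    by (intro linear_compose_sub matrix_vector_mul_linear linear_ident)
  have "x = 0" if "?f x = 0" for x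
  proof -
    have "matrix_power M N *v x = x" for N
      using that by (induction N) (simp_all add: matrix_power_Suc_vector del: matrix_power.simps(2))
    then show ?thesis
      using matrix_power_vector_tendsto_0[OF lim, of x] LIMSEQ_const_iff by auto
  qed
  then have "inj ?f"
    using lin linear_injective_0 by blast
  then have "surj ?f"
    using lin linear_injective_imp_surjective by blast
  then obtain x where "c = ?f x"
    by (meson surjD)
  then have "x = c + M *v x"
    by simp
  then show ?thesis ..
qed

lemma affine_iterate_tendsto:
  fixes M :: "real^'n^'n"
  assumes lim: "(\<lambda>N. matrix_power M N) \<longlonglongrightarrow> 0" and fp: "x = c + M *v x"
  shows "(\<lambda>N. ((\<lambda>y. c + M *v y) ^^ N) y) \<longlonglongrightarrow> x"
proof -
  have "(\<lambda>N. x + matrix_power M N *v (y - x)) \<longlonglongrightarrow> x + 0"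
    by (intro tendsto_intros matrix_power_vector_tendsto_0 lim)
  then show ?thesis
    by (simp add: affine_iterate[OF fp])
qed

text \<open>
  The next two lemmas characterize vanishing powers of a nonnegative matrix by strict
  superharmonic vectors. In one direction the Neumann series of \<open>M\<close> applied to the all-ones
  vector would do; a finite piece of it already suffices, since \<open>M\<^sup>N 1 \<le> 1/2\<close> for some \<open>N\<close> makes
  \<open>w = 2 (1 + M 1 + \<dots> + M\<^sup>N\<^sup>-\<^sup>1 1)\<close> telescope to \<open>M w = w - 2 + 2 M\<^sup>N 1 \<le> w - 1\<close>.
\<close>

lemma strict_superharmonic_exists:
  fixes M :: "real^'n^'n"
  assumes M: "0 \<le> M" and lim: "(\<lambda>N. matrix_power M N) \<longlonglongrightarrow> 0"
  shows "\<exists>w. 0 \<le> w \<and> M *v w + 1 \<le> w"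
proof -
  define x where "x N = matrix_power M N *v (1 :: real^'n)" for N
  have x0: "x 0 = 1"
    by (simp add: x_def)
  have xS: "M *v x N = x (Suc N)" for N
    by (simp add: x_def matrix_vector_mul_assoc)
  have nonneg: "0 \<le> x N" for N
    unfolding x_def using matrix_vector_mult_mono[OF matrix_power_nonneg[OF M], of 0 1 N]
    by (simp add: less_eq_vec_def)
  have "x \<longlonglongrightarrow> 0"
    unfolding x_def by (rule matrix_power_vector_tendsto_0[OF lim])
  then have "\<forall>\<^sub>F N in sequentially. x N $ i < 1/2" for i
    using order_tendstoD(2)[OF tendsto_vec_nth[of x 0 sequentially i], of "1/2"] by simp
  then have "\<forall>\<^sub>F N in sequentially. \<forall>i. x N $ i < 1/2"
    by (simp add: eventually_all_finite)
  then obtain N where N: "\<And>i. x N $ i < 1/2"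
    by (auto simp: eventually_sequentially)
  define w where "w = 2 *\<^sub>R (\<Sum>k<N. x k)"
  have "M *v (\<Sum>k<m. x k) = (\<Sum>k<m. x k) + x m - 1" for m
    by (induction m) (simp_all add: x0 xS matrix_vector_right_distrib)
  then have Mw: "M *v w = w + 2 *\<^sub>R x N - 2 *\<^sub>R 1"
    by (simp add: w_def matrix_vector_mult_scaleR scaleR_add_right scaleR_diff_right)
  have "(M *v w + 1) $ i \<le> w $ i" for i
    using N[of i] by (simp add: Mw)
  moreover have "0 \<le> w $ i" for i
    using nonneg by (auto simp: w_def less_eq_vec_def intro!: sum_nonneg)
  ultimately show ?thesis
    by (auto simp: less_eq_vec_def)
qed

text \<open>
  Conversely, the loss of \<open>c\<close> in each step is at least a fixed fraction of the bounded vector \<open>w\<close>,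
  which makes \<open>M\<close> a contraction in the maximum norm weighted by \<open>w\<close>. The entries of \<open>w\<close> are at
  least \<open>c\<close>, so this norm controls the matrix entries.
\<close>

lemma matrix_power_tendsto_0_if_strict_superharmonic:
  fixes M :: "real^'n^'n"
  assumes M: "0 \<le> M" and w: "0 \<le> w" and c: "0 < (c::real)"
    and dec: "\<And>i. (M *v w) $ i + c \<le> w $ i"
  shows "(\<lambda>N. matrix_power M N) \<longlonglongrightarrow> 0"
proof -
  define B where "B = (\<Sum>j\<in>UNIV. w $ j) + c"
  have w0: "0 \<le> w $ i" for i
    using w by (simp add: less_eq_vec_def)
  have S0: "0 \<le> (\<Sum>j\<in>UNIV. w $ j)"
    by (simp add: sum_nonneg w0)
  have B: "c \<le> B" "0 < B"
    using c S0 by (auto simp: B_def)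
  have wB: "w $ i \<le> B" for i
    using member_le_sum[of i UNIV "\<lambda>j. w $ j"] w0 c by (simp add: B_def)
  define r where "r = 1 - c / B"
  have r: "0 \<le> r" "r < 1"
    using B c by (auto simp: r_def field_simps)
  have step: "M *v w \<le> r *\<^sub>R w"
    unfolding less_eq_vec_def
  proof
    fix i
    have "c * w $ i \<le> c * B"
      using c wB by (simp add: mult_left_mono)
    then have "c / B * w $ i \<le> c"
      using B by (simp add: field_simps)
    then show "(M *v w) $ i \<le> (r *\<^sub>R w) $ i"
      using dec[of i] by (simp add: r_def algebra_simps)
  qed
  have pow: "matrix_power M N *v w \<le> r ^ N *\<^sub>R w" for N
  proof (induction N)
    case (Suc N)
    have "matrix_power M (Suc N) *v w \<le> M *v (r ^ N *\<^sub>R w)"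
      unfolding matrix_power_Suc_vector by (rule matrix_vector_mult_mono[OF M Suc])
    also have "\<dots> = r ^ N *\<^sub>R (M *v w)"
      by (simp add: matrix_vector_mult_scaleR)
    also have "\<dots> \<le> r ^ Suc N *\<^sub>R w"
      unfolding less_eq_vec_def
    proof
      fix i
      have "r ^ N * (M *v w) $ i \<le> r ^ N * (r * w $ i)"
        using step r by (intro mult_left_mono) (auto simp: less_eq_vec_def)
      then show "(r ^ N *\<^sub>R (M *v w)) $ i \<le> (r ^ Suc N *\<^sub>R w) $ i"
        by (simp add: ac_simps)
    qed
    finally show ?case .
  qed simp
  have wc: "c \<le> w $ j" for j
  proof -
    have "0 \<le> (M *v w) $ j"
      using matrix_vector_mult_mono[OF M w] by (simp add: less_eq_vec_def)
    then show ?thesis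
      using dec[of j] by simp
  qed
  have P0: "0 \<le> matrix_power M N $ i $ j" for N i j
    using matrix_power_nonneg[OF M, of N] by (simp add: less_eq_vec_def)
  have bound: "matrix_power M N $ i $ j \<le> r ^ N * (w $ i / c)" for N i j
  proof -
    have "matrix_power M N $ i $ j * c \<le> matrix_power M N $ i $ j * w $ j"
      by (rule mult_left_mono[OF wc P0])
    also have "\<dots> \<le> (matrix_power M N *v w) $ i"
      unfolding matrix_vector_mult_def using w0 P0
      by (auto intro!: member_le_sum)
    also have "\<dots> \<le> r ^ N * w $ i"
      using pow[of N] by (simp add: less_eq_vec_def)
    finally show ?thesis
      using c by (simp add: field_simps)
  qed
  have "(\<lambda>N. matrix_power M N $ i $ j) \<longlonglongrightarrow> 0" for i j
  proof (rule tendsto_sandwich[OF _ _ tendsto_const])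
    show "(\<lambda>N. r ^ N * (w $ i / c)) \<longlonglongrightarrow> 0"
      by (rule tendsto_mult_left_zero[OF LIMSEQ_realpow_zero[OF r]])
  qed (use P0 bound in auto)
  then show ?thesis
    by (auto intro!: vec_tendstoI)
qed

section \<open>Bellman operators on finite vectors\<close>

definition ennreal_vec :: "real^'n \<Rightarrow> ennreal^'n" where
  "ennreal_vec x = (\<chi> i. ennreal (x $ i))"

lemma ennreal_vec_nth [simp]: "ennreal_vec x $ i = ennreal (x $ i)"
  by (simp add: ennreal_vec_def)

lemma ennreal_vec_finite [simp]: "ennreal_vec x \<in> finite_vecs"
  by (simp add: finite_vecs_def)

lemma finite_vecsE:
  assumes "J \<in> finite_vecs"
  obtains x where "0 \<le> x" "J = ennreal_vec x"
proof
  show "0 \<le> (\<chi> i. enn2real (J $ i))"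
    by (simp add: less_eq_vec_def)
  show "J = ennreal_vec (\<chi> i. enn2real (J $ i))"
    using assms by (simp add: finite_vecs_def vec_eq_iff)
qed

lemma tendsto_ennreal_vec:
  assumes "f \<longlonglongrightarrow> x"
  shows "(\<lambda>N. ennreal_vec (f N)) \<longlonglongrightarrow> ennreal_vec x"
  by (rule vec_tendstoI) (auto intro!: tendsto_ennrealI tendsto_vec_nth assms)

lemma ennreal_vec_LIMSEQ_le:
  fixes J :: "ennreal^'n"
  assumes "f \<longlonglongrightarrow> L" "\<And>N. J \<le> f N"
  shows "J \<le> L"
  unfolding less_eq_vec_def
proof
  fix i
  show "J $ i \<le> L $ i"
    by (rule LIMSEQ_le_const[OF tendsto_vec_nth[OF assms(1)]])
      (use assms(2) in \<open>auto simp: less_eq_vec_def\<close>)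
qed

lemma ennreal_vec_LIMSEQ_le2:
  fixes J :: "ennreal^'n"
  assumes "f \<longlonglongrightarrow> L" "\<And>N. f N \<le> J"
  shows "L \<le> J"
  unfolding less_eq_vec_def
proof
  fix i
  show "L $ i \<le> J $ i"
    by (rule LIMSEQ_le_const2[OF tendsto_vec_nth[OF assms(1)]])
      (use assms(2) in \<open>auto simp: less_eq_vec_def\<close>)
qed

lemma T_pol_mono: "J \<le> K \<Longrightarrow> T_pol b A \<mu> J \<le> T_pol b A \<mu> K"
  by (auto simp: T_pol_def less_eq_vec_def intro!: add_left_mono sum_mono mult_left_mono)

lemma T_opt_mono: "J \<le> K \<Longrightarrow> T_opt U b A J \<le> T_opt U b A K"
  by (auto simp: T_opt_def less_eq_vec_def intro!: INF_mono' add_left_mono sum_mono mult_left_mono)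

lemma T_opt_le_T_pol:
  assumes "\<mu> \<in> policies U"
  shows "T_opt U b A J \<le> T_pol b A \<mu> J"
  using assms
  by (auto simp: T_opt_def T_pol_def b_pol_def A_pol_def less_eq_vec_def policies_def intro!: INF_lower)

lemma ennreal_less_add:
  assumes "a < top" "0 < e"
  shows "a < a + ennreal e"
  using ennreal_add_left_cancel_less[of a 0 "ennreal e"] assms by simp

lemma funpow_ge:
  fixes J :: "'a::order"
  assumes "\<And>K L. K \<le> L \<Longrightarrow> f K \<le> f L" "J \<le> f J"
  shows "J \<le> (f ^^ N) J"
proof (induction N)
  case (Suc N)
  have "J \<le> f J" by fact
  also have "\<dots> \<le> f ((f ^^ N) J)" by (rule assms(1)[OF Suc])
  finally show ?case by simp
qed simp

lemma funpow_le:
  fixes J :: "'a::order"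
  assumes "\<And>K L. K \<le> L \<Longrightarrow> f K \<le> f L" "f J \<le> J"
  shows "(f ^^ N) J \<le> J"
proof (induction N)
  case (Suc N)
  have "f ((f ^^ N) J) \<le> f J" by (rule assms(1)[OF Suc])
  also have "\<dots> \<le> J" by fact
  finally show ?case by simp
qed simp

section \<open>Contractive policies\<close>

locale affine_monotonic =
  fixes U :: "'n::finite \<Rightarrow> 'u set"
    and b :: "'n \<Rightarrow> 'u \<Rightarrow> real"
    and A :: "'n \<Rightarrow> 'n \<Rightarrow> 'u \<Rightarrow> real"
    and Jbar :: "ennreal ^ 'n"
  assumes U_nonempty: "U i \<noteq> {}"
    and b_nonneg: "u \<in> U i \<Longrightarrow> 0 \<le> b i u"
    and A_nonneg: "u \<in> U i \<Longrightarrow> 0 \<le> A i j u"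
    and Jbar: "Jbar \<in> finite_vecs"
    and contractive_exists: "contractive_policies U A \<noteq> {}"
begin

abbreviation contractive :: "('n \<Rightarrow> 'u) set" where
  "contractive \<equiv> contractive_policies U A"

abbreviation cost :: "('n \<Rightarrow> 'u) \<Rightarrow> ennreal ^ 'n" where
  "cost \<equiv> policy_cost b A Jbar"

abbreviation Tp :: "('n \<Rightarrow> 'u) \<Rightarrow> ennreal ^ 'n \<Rightarrow> ennreal ^ 'n" where
  "Tp \<equiv> T_pol b A"

abbreviation T :: "ennreal ^ 'n \<Rightarrow> ennreal ^ 'n" where
  "T \<equiv> T_opt U b A"

abbreviation Jhat :: "ennreal ^ 'n" where
  "Jhat \<equiv> contractive_opt_cost U b A Jbar"

lemma contractive_policy: "\<mu> \<in> contractive \<Longrightarrow> \<mu> \<in> policies U"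
  by (simp add: contractive_policies_def)

lemma b_pol_nonneg: "\<mu> \<in> policies U \<Longrightarrow> 0 \<le> b_pol b \<mu>"
  using b_nonneg by (auto simp: b_pol_def policies_def less_eq_vec_def)

lemma A_pol_nonneg: "\<mu> \<in> policies U \<Longrightarrow> 0 \<le> A_pol A \<mu>"
  using A_nonneg by (auto simp: A_pol_def policies_def less_eq_vec_def)

lemma T_pol_real_nonneg:
  assumes "\<mu> \<in> policies U" "0 \<le> x"
  shows "0 \<le> b_pol b \<mu> + A_pol A \<mu> *v x"
  using b_pol_nonneg[OF assms(1)] matrix_vector_mult_mono[OF A_pol_nonneg[OF assms(1)] assms(2)]
  by (auto simp: less_eq_vec_def)

lemma T_pol_ennreal_vec:
  assumes "\<mu> \<in> policies U" "0 \<le> x"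
  shows "Tp \<mu> (ennreal_vec x) = ennreal_vec (b_pol b \<mu> + A_pol A \<mu> *v x)"
proof -
  have "0 \<le> x $ j" "0 \<le> A_pol A \<mu> $ i $ j" "0 \<le> b_pol b \<mu> $ i" for i j
    using assms(2) b_pol_nonneg[OF assms(1)] A_pol_nonneg[OF assms(1)] by (auto simp: less_eq_vec_def)
  then show ?thesis
    by (simp add: vec_eq_iff T_pol_def matrix_vector_mult_def sum_nonneg flip: ennreal_mult)
qed

lemma T_pol_funpow_ennreal_vec:
  assumes "\<mu> \<in> policies U" "0 \<le> x"
  shows "(Tp \<mu> ^^ N) (ennreal_vec x) = ennreal_vec (((\<lambda>y. b_pol b \<mu> + A_pol A \<mu> *v y) ^^ N) x)"
    and "0 \<le> ((\<lambda>y. b_pol b \<mu> + A_pol A \<mu> *v y) ^^ N) x"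
proof (induction N)
  case 0
  {
    case 1 then show ?case by simp
  next
    case 2 then show ?case using assms by simp
  }
next
  case (Suc N)
  {
    case 1 then show ?case using assms Suc by (simp add: T_pol_ennreal_vec)
  next
    case 2 then show ?case using assms Suc by (simp add: T_pol_real_nonneg)
  }
qed

text \<open>
  The cost of a contractive policy is the limit of real affine iterations, and that limit forgets
  the starting vector. Nonnegativity of the fixed point is inherited from the iterates of \<open>0\<close>.
\<close>

lemma contractive_cost:
  assumes \<mu>: "\<mu> \<in> contractive"
  obtains x where "0 \<le> x" "x = b_pol b \<mu> + A_pol A \<mu> *v x" "cost \<mu> = ennreal_vec x"
    "\<And>J. J \<in> finite_vecs \<Longrightarrow> (\<lambda>N. (Tp \<mu> ^^ N) J) \<longlonglongrightarrow> cost \<mu>"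
proof -
  have pol: "\<mu> \<in> policies U" and lim: "(\<lambda>N. matrix_power (A_pol A \<mu>) N) \<longlonglongrightarrow> 0"
    using \<mu> by (auto simp: contractive_policies_def)
  let ?f = "\<lambda>y. b_pol b \<mu> + A_pol A \<mu> *v y"
  obtain x where x: "x = ?f x"
    using affine_fixed_point_exists[OF lim] by blast
  note real_lim = affine_iterate_tendsto[OF lim x]
  have "0 \<le> x $ i" for i
  proof (rule LIMSEQ_le_const[OF tendsto_vec_nth[OF real_lim]])
    show "\<exists>N. \<forall>n\<ge>N. 0 \<le> (?f ^^ n) 0 $ i"
      using T_pol_funpow_ennreal_vec(2)[OF pol, of 0] by (simp add: less_eq_vec_def)
  qed
  then have x0: "0 \<le> x"
    by (simp add: less_eq_vec_def)
  have conv: "(\<lambda>N. (Tp \<mu> ^^ N) J) \<longlonglongrightarrow> ennreal_vec x" if J: "J \<in> finite_vecs" for J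
  proof -
    obtain y where "0 \<le> y" "J = ennreal_vec y"
      using J by (rule finite_vecsE)
    then show ?thesis
      using tendsto_ennreal_vec[OF real_lim, of y] pol by (simp add: T_pol_funpow_ennreal_vec)
  qed
  have "cost \<mu> = ennreal_vec x"
    unfolding policy_cost_def vec_eq_iff vec_lambda_beta
    by (intro allI lim_imp_Limsup tendsto_vec_nth conv Jbar) simp
  with x x0 conv that show thesis
    by simp
qed

lemma contractive_cost_finite: "\<mu> \<in> contractive \<Longrightarrow> cost \<mu> \<in> finite_vecs"
  by (metis contractive_cost ennreal_vec_finite)

lemma contractive_cost_fixed_point:
  assumes "\<mu> \<in> contractive"
  shows "Tp \<mu> (cost \<mu>) = cost \<mu>"
  by (metis contractive_cost[OF assms] T_pol_ennreal_vec contractive_policy assms)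

lemma contractive_tendsto_cost:
  "\<mu> \<in> contractive \<Longrightarrow> J \<in> finite_vecs \<Longrightarrow> (\<lambda>N. (Tp \<mu> ^^ N) J) \<longlonglongrightarrow> cost \<mu>"
  by (metis contractive_cost)

lemma le_contractive_cost:
  assumes "\<mu> \<in> contractive" "J \<in> finite_vecs" "J \<le> Tp \<mu> J"
  shows "J \<le> cost \<mu>"
  using contractive_tendsto_cost[OF assms(1,2)]
  by (rule ennreal_vec_LIMSEQ_le) (intro funpow_ge T_pol_mono assms(3))

lemma contractive_cost_le:
  assumes "\<mu> \<in> contractive" "J \<in> finite_vecs" "Tp \<mu> J \<le> J"
  shows "cost \<mu> \<le> J"
  using contractive_tendsto_cost[OF assms(1,2)]
  by (rule ennreal_vec_LIMSEQ_le2) (intro funpow_le T_pol_mono assms(3))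

text \<open>
  Raising the cost vector by a multiple of a strictly superharmonic vector leaves, in every
  component, slack proportional to the size of the perturbation.
\<close>

lemma contractive_cost_perturbation:
  assumes \<mu>: "\<mu> \<in> contractive"
  shows "\<exists>w. 0 \<le> w \<and> (\<forall>c\<ge>0. \<forall>i. Tp \<mu> (cost \<mu> + ennreal_vec (c *\<^sub>R w)) $ i + ennreal c
    \<le> (cost \<mu> + ennreal_vec (c *\<^sub>R w)) $ i)"
proof -
  have pol: "\<mu> \<in> policies U" and lim: "(\<lambda>N. matrix_power (A_pol A \<mu>) N) \<longlonglongrightarrow> 0"
    using \<mu> by (auto simp: contractive_policies_def)
  obtain x where x: "0 \<le> x" "x = b_pol b \<mu> + A_pol A \<mu> *v x" "cost \<mu> = ennreal_vec x"
    using contractive_cost[OF \<mu>] by metis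
  obtain w where w: "0 \<le> w" "A_pol A \<mu> *v w + 1 \<le> w"
    using strict_superharmonic_exists[OF A_pol_nonneg[OF pol] lim] by blast
  have "Tp \<mu> (cost \<mu> + ennreal_vec (c *\<^sub>R w)) $ i + ennreal c
      \<le> (cost \<mu> + ennreal_vec (c *\<^sub>R w)) $ i" if c: "0 \<le> c" for c i
  proof -
    let ?y = "x + c *\<^sub>R w"
    have y0: "0 \<le> ?y"
      using x(1) w(1) c by (simp add: less_eq_vec_def)
    have eq: "cost \<mu> + ennreal_vec (c *\<^sub>R w) = ennreal_vec ?y"
      using x(1) w(1) c by (simp add: x(3) vec_eq_iff less_eq_vec_def)
    have "b_pol b \<mu> + A_pol A \<mu> *v ?y = x + c *\<^sub>R (A_pol A \<mu> *v w)"
      using x(2) by (simp add: matrix_vector_right_distrib matrix_vector_mult_scaleR flip: add.assoc)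
    moreover have "c * (A_pol A \<mu> *v w) $ i + c \<le> c * w $ i"
    proof -
      have "(A_pol A \<mu> *v w) $ i + 1 \<le> w $ i"
        using w(2) by (simp add: less_eq_vec_def)
      from mult_left_mono[OF this c] show ?thesis by (simp add: algebra_simps)
    qed
    ultimately have le: "(b_pol b \<mu> + A_pol A \<mu> *v ?y) $ i + c \<le> ?y $ i"
      by simp
    have "0 \<le> (b_pol b \<mu> + A_pol A \<mu> *v ?y) $ i" "0 \<le> ?y $ i"
      using T_pol_real_nonneg[OF pol y0] y0 by (auto simp: less_eq_vec_def)
    then show ?thesis
      unfolding eq T_pol_ennreal_vec[OF pol y0] ennreal_vec_nth
      using c le by (metis ennreal_le_iff ennreal_plus)
  qed
  with w(1) show ?thesis by blast
qed

section \<open>Optimal cost over contractive policies\<close>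

lemma Jhat_le_cost: "\<mu> \<in> contractive \<Longrightarrow> Jhat \<le> cost \<mu>"
  by (auto simp: contractive_opt_cost_def less_eq_vec_def intro!: INF_lower)

lemma le_Jhat: "(\<And>\<mu>. \<mu> \<in> contractive \<Longrightarrow> J \<le> cost \<mu>) \<Longrightarrow> J \<le> Jhat"
  by (auto simp: contractive_opt_cost_def less_eq_vec_def intro!: INF_greatest)

lemma Jhat_finite: "Jhat \<in> finite_vecs"
proof -
  obtain \<mu> where "\<mu> \<in> contractive"
    using contractive_exists by blast
  with Jhat_le_cost contractive_cost_finite show ?thesis
    unfolding finite_vecs_def less_eq_vec_def by (blast intro: le_less_trans)
qed

lemma subsolution_le_Jhat:
  assumes "J \<in> finite_vecs" "J \<le> T J"
  shows "J \<le> Jhat"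
  by (intro le_Jhat le_contractive_cost order_trans[OF assms(2)] T_opt_le_T_pol contractive_policy
      assms(1))

lemma T_Jhat_le: "T Jhat \<le> Jhat"
proof (rule le_Jhat)
  fix \<mu> assume \<mu>: "\<mu> \<in> contractive"
  have "T Jhat \<le> T (cost \<mu>)"
    by (intro T_opt_mono Jhat_le_cost \<mu>)
  also have "\<dots> \<le> Tp \<mu> (cost \<mu>)"
    by (intro T_opt_le_T_pol contractive_policy \<mu>)
  also have "\<dots> = cost \<mu>"
    by (rule contractive_cost_fixed_point[OF \<mu>])
  finally show "T Jhat \<le> cost \<mu>" .
qed

text \<open>
  Policy improvement with slack: if \<open>T J\<close> lies below \<open>J\<close> by a uniform margin \<open>c\<close>, a policy that is
  greedy for \<open>J\<close> up to \<open>c / 2\<close> keeps the margin \<open>c / 2\<close>. This remaining margin forces the policy to be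
  contractive, so that its cost, which is at most \<open>T J + c / 2\<close>, competes in the infimum \<open>Jhat\<close>.
\<close>

lemma Jhat_le_of_strict_supersolution:
  assumes J: "J \<in> finite_vecs" and c: "0 < (c::real)"
    and dec: "\<And>i. T J $ i + ennreal c \<le> J $ i"
  shows "Jhat $ i \<le> T J $ i + ennreal c"
proof -
  obtain x where x: "0 \<le> x" "J = ennreal_vec x"
    using J by (rule finite_vecsE)
  have half: "ennreal c = ennreal (c/2) + ennreal (c/2)"
    using c by (simp flip: ennreal_plus)
  have "\<exists>u\<in>U i. ennreal (b i u) + (\<Sum>j\<in>UNIV. ennreal (A i j u) * J $ j) < T J $ i + ennreal (c/2)"
    for i
  proof -
    have "T J $ i \<le> J $ i"
      using dec[of i] by (meson le_add_same_cancel1 order_trans zero_le add_increasing2 order_refl)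
    also have "J $ i < top"
      using J by (simp add: finite_vecs_def)
    finally have "T J $ i < T J $ i + ennreal (c/2)"
      using c by (intro ennreal_less_add) auto
    then show ?thesis
      by (subst (asm) (1) T_opt_def) (simp add: INF_less_iff)
  qed
  then obtain \<mu> where \<mu>: "\<And>i. \<mu> i \<in> U i" "\<And>i. ennreal (b i (\<mu> i)) +
      (\<Sum>j\<in>UNIV. ennreal (A i j (\<mu> i)) * J $ j) < T J $ i + ennreal (c/2)"
    by metis
  have pol: "\<mu> \<in> policies U"
    using \<mu>(1) by (simp add: policies_def)
  have greedy: "Tp \<mu> J $ i \<le> T J $ i + ennreal (c/2)" for i
    using \<mu>(2)[of i] by (simp add: T_pol_def b_pol_def A_pol_def less_imp_le)
  have slack: "Tp \<mu> J $ i + ennreal (c/2) \<le> J $ i" for i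
  proof -
    have "Tp \<mu> J $ i + ennreal (c/2) \<le> T J $ i + ennreal (c/2) + ennreal (c/2)"
      by (rule add_right_mono[OF greedy])
    also have "\<dots> = T J $ i + ennreal c"
      by (simp only: half add.assoc)
    also have "\<dots> \<le> J $ i"
      by (rule dec)
    finally show ?thesis .
  qed
  have "(A_pol A \<mu> *v x) $ i + c/2 \<le> x $ i" for i
  proof -
    let ?t = "(b_pol b \<mu> + A_pol A \<mu> *v x) $ i"
    have "0 \<le> ?t" "0 \<le> x $ i" "0 \<le> b_pol b \<mu> $ i"
      using T_pol_real_nonneg[OF pol x(1)] x(1) b_pol_nonneg[OF pol] by (auto simp: less_eq_vec_def)
    moreover from this have "ennreal (?t + c/2) \<le> ennreal (x $ i)"
      using slack[of i] c by (simp add: x(2) T_pol_ennreal_vec[OF pol x(1)] del: vector_add_component)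
    ultimately show ?thesis
      by (simp add: ennreal_le_iff)
  qed
  then have "\<mu> \<in> contractive"
    using matrix_power_tendsto_0_if_strict_superharmonic[OF A_pol_nonneg[OF pol] x(1), of "c/2"] c pol
    by (simp add: contractive_policies_def)
  moreover have le: "Tp \<mu> J \<le> J"
    unfolding less_eq_vec_def using slack by (metis add_increasing2 order_refl order_trans zero_le)
  moreover have fin: "Tp \<mu> J \<in> finite_vecs"
    using x by (simp add: T_pol_ennreal_vec[OF pol])
  ultimately have "Jhat \<le> Tp \<mu> J"
    by (meson Jhat_le_cost contractive_cost_le T_pol_mono order_trans)
  then have "Jhat $ i \<le> T J $ i + ennreal (c/2)"
    using greedy[of i] by (auto simp: less_eq_vec_def intro: order_trans)
  also have "\<dots> \<le> T J $ i + ennreal c"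
    using c by (intro add_left_mono ennreal_leI) simp
  finally show ?thesis .
qed

text \<open>
  The infima defining the components of \<open>Jhat\<close> may be approached by different policies. Since there
  are finitely many components, one takes the minimum of finitely many perturbed costs: a minimum
  of vectors that decrease under \<open>T\<close> by a margin again decreases by that margin.
\<close>

lemma strict_supersolution_near_Jhat:
  assumes e: "0 < (e::real)"
  shows "\<exists>J c. J \<in> finite_vecs \<and> 0 < c \<and> c \<le> e \<and> (\<forall>i. T J $ i + ennreal c \<le> J $ i) \<and>
    (\<forall>i. J $ i \<le> Jhat $ i + ennreal e)"
proof -
  have "\<exists>\<mu>\<in>contractive. cost \<mu> $ j < Jhat $ j + ennreal (e/2)" for j
  proof -
    have "Jhat $ j < Jhat $ j + ennreal (e/2)"
      using Jhat_finite e by (intro ennreal_less_add) (auto simp: finite_vecs_def)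
    then show ?thesis
      by (subst (asm) (1) contractive_opt_cost_def) (simp add: INF_less_iff)
  qed
  then obtain m where m: "\<And>j. m j \<in> contractive" "\<And>j. cost (m j) $ j < Jhat $ j + ennreal (e/2)"
    by metis
  obtain w where w: "\<And>j. 0 \<le> w j" "\<And>j c i. 0 \<le> c \<Longrightarrow>
      Tp (m j) (cost (m j) + ennreal_vec (c *\<^sub>R w j)) $ i + ennreal c
      \<le> (cost (m j) + ennreal_vec (c *\<^sub>R w j)) $ i"
    using contractive_cost_perturbation[OF m(1)] by metis
  define S where "S = (\<Sum>j\<in>UNIV. w j $ j)"
  define c where "c = e / (2 * (1 + S))"
  have w0: "0 \<le> w j $ i" for i j
    using w(1) by (simp add: less_eq_vec_def)
  have S0: "0 \<le> S"
    unfolding S_def by (intro sum_nonneg w0)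
  have c: "0 < c"
    using e S0 by (simp add: c_def)
  have cS: "c * (1 + S) = e / 2"
    using S0 by (simp add: c_def field_simps)
  have "c * 1 \<le> c * (1 + S)"
    using c S0 by (intro mult_left_mono) auto
  then have ce: "c \<le> e"
    using cS e by simp
  have cw: "c * w j $ j \<le> e / 2" for j
  proof -
    have "w j $ j \<le> S"
      unfolding S_def using member_le_sum[of j UNIV "\<lambda>j. w j $ j"] w0 by simp
    then have "c * w j $ j \<le> c * (1 + S)"
      using c by (intro mult_left_mono) auto
    then show ?thesis using cS by simp
  qed
  define K where "K j = cost (m j) + ennreal_vec (c *\<^sub>R w j)" for j
  define J where "J = (\<chi> i. INF j. K j $ i)"
  have JK: "J \<le> K j" for j
    by (auto simp: J_def less_eq_vec_def intro!: INF_lower)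
  have near: "J $ j \<le> Jhat $ j + ennreal e" for j
  proof -
    have "J $ j \<le> K j $ j"
      using JK by (simp add: less_eq_vec_def)
    also have "\<dots> \<le> (Jhat $ j + ennreal (e/2)) + ennreal (e/2)"
      using add_mono[OF less_imp_le[OF m(2)[of j]] ennreal_leI[OF cw[of j]]]
      by (simp add: K_def)
    also have "\<dots> = Jhat $ j + ennreal e"
      using e by (simp add: add.assoc flip: ennreal_plus)
    finally show ?thesis .
  qed
  have "T J $ i + ennreal c \<le> J $ i" for i
  proof -
    have "T J $ i + ennreal c \<le> K j $ i" for j
    proof -
      have "T J \<le> Tp (m j) (K j)"
        by (rule order_trans[OF T_opt_mono[OF JK[of j]]]) (intro T_opt_le_T_pol contractive_policy m(1))
      then have "T J $ i + ennreal c \<le> Tp (m j) (K j) $ i + ennreal c"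
        by (auto simp: less_eq_vec_def intro: add_right_mono)
      also have "\<dots> \<le> K j $ i"
        unfolding K_def using w(2) c by simp
      finally show ?thesis .
    qed
    then show ?thesis
      by (auto simp: J_def intro!: INF_greatest)
  qed
  moreover have "J \<in> finite_vecs"
    unfolding finite_vecs_def
  proof safe
    fix j
    show "J $ j < \<infinity>"
      using near[of j] Jhat_finite by (auto simp: finite_vecs_def intro: le_less_trans)
  qed
  ultimately show ?thesis
    using c ce near by blast
qed

lemma Jhat_le_T_Jhat: "Jhat \<le> T Jhat"
  unfolding less_eq_vec_def
proof
  fix i
  have "Jhat $ i \<le> ennreal (b i u) + (\<Sum>j\<in>UNIV. ennreal (A i j u) * Jhat $ j)"
    if u: "u \<in> U i" for u
  proof (rule ennreal_le_epsilon)
    fix d :: real assume d: "0 < d"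
    define a where "a = (\<Sum>j\<in>UNIV. A i j u)"
    have a: "0 \<le> a"
      unfolding a_def by (intro sum_nonneg A_nonneg u)
    \<comment> \<open>An error \<open>e\<close> in every component of \<open>J\<close> enters with total weight \<open>a\<close>, and the slack adds one more \<open>e\<close>.\<close>
    define e where "e = d / (1 + a)"
    have e: "0 < e"
      using d a by (simp add: e_def)
    have "(1 + a) * e = d"
      using a by (simp add: e_def)
    then have ed: "a * e + e = d"
      by (simp add: algebra_simps)
    obtain J c where J: "J \<in> finite_vecs" "0 < c" "c \<le> e" "\<And>i. T J $ i + ennreal c \<le> J $ i"
      "\<And>i. J $ i \<le> Jhat $ i + ennreal e"
      using strict_supersolution_near_Jhat[OF e] by blast
    have "Jhat $ i \<le> T J $ i + ennreal c"
      by (rule Jhat_le_of_strict_supersolution[OF J(1,2,4)])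
    also have "\<dots> \<le> (ennreal (b i u) + (\<Sum>j\<in>UNIV. ennreal (A i j u) * J $ j)) + ennreal e"
      using J(3) u by (auto simp: T_opt_def intro!: add_mono INF_lower ennreal_leI)
    also have "\<dots> \<le> (ennreal (b i u) + (\<Sum>j\<in>UNIV. ennreal (A i j u) * (Jhat $ j + ennreal e)))
        + ennreal e"
      using J(5) by (intro add_mono sum_mono mult_left_mono order_refl) auto
    also have "(\<Sum>j\<in>UNIV. ennreal (A i j u) * (Jhat $ j + ennreal e))
        = (\<Sum>j\<in>UNIV. ennreal (A i j u) * Jhat $ j) + ennreal (a * e)"
      using e a u by (simp add: distrib_left sum.distrib a_def sum_distrib_right[symmetric]
          ennreal_mult A_nonneg sum_nonneg flip: sum_ennreal)
    also have "ennreal (b i u) + ((\<Sum>j\<in>UNIV. ennreal (A i j u) * Jhat $ j) + ennreal (a * e)) + ennreal e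
        = (ennreal (b i u) + (\<Sum>j\<in>UNIV. ennreal (A i j u) * Jhat $ j)) + ennreal d"
      using e a by (simp add: add.assoc flip: ed)
    finally show "Jhat $ i \<le> ennreal (b i u) + (\<Sum>j\<in>UNIV. ennreal (A i j u) * Jhat $ j) + ennreal d" .
  qed
  then show "Jhat $ i \<le> T Jhat $ i"
    by (auto simp: T_opt_def intro!: INF_greatest)
qed

lemma T_Jhat: "T Jhat = Jhat"
  by (intro antisym T_Jhat_le Jhat_le_T_Jhat)

text \<open>
  Value iteration from above is squeezed between its fixed point \<open>Jhat\<close> and the iterates of each
  contractive policy, whose limits come arbitrarily close to \<open>Jhat\<close> in any given component.
\<close>

lemma value_iteration_tendsto_Jhat:
  assumes J: "J \<in> finite_vecs" "Jhat \<le> J"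
  shows "(\<lambda>k. (T ^^ k) J) \<longlonglongrightarrow> Jhat"
proof (rule vec_tendstoI)
  fix i
  have lower: "Jhat \<le> (T ^^ k) J" for k
  proof (induction k)
    case (Suc k)
    then show ?case
      using T_opt_mono[OF Suc, of U b A] by (simp add: T_Jhat)
  qed (simp add: J)
  have upper: "(T ^^ k) J \<le> (Tp \<mu> ^^ k) J" if "\<mu> \<in> contractive" for k \<mu>
  proof (induction k)
    case (Suc k)
    have "T ((T ^^ k) J) \<le> Tp \<mu> ((T ^^ k) J)"
      by (intro T_opt_le_T_pol contractive_policy that)
    also have "\<dots> \<le> Tp \<mu> ((Tp \<mu> ^^ k) J)"
      by (intro T_pol_mono Suc)
    finally show ?case by simp
  qed simp
  show "(\<lambda>k. (T ^^ k) J $ i) \<longlonglongrightarrow> Jhat $ i"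
  proof (rule order_tendstoI)
    fix l assume l: "l < Jhat $ i"
    have "l < (T ^^ k) J $ i" for k
      using l lower[of k] unfolding less_eq_vec_def by (meson less_le_trans)
    then show "\<forall>\<^sub>F k in sequentially. l < (T ^^ k) J $ i"
      by simp
  next
    fix r assume "Jhat $ i < r"
    then obtain \<mu> where \<mu>: "\<mu> \<in> contractive" "cost \<mu> $ i < r"
      by (auto simp: contractive_opt_cost_def INF_less_iff)
    have "\<forall>\<^sub>F k in sequentially. (Tp \<mu> ^^ k) J $ i < r"
      using tendsto_vec_nth[OF contractive_tendsto_cost[OF \<mu>(1) J(1)]] \<mu>(2)
      by (rule order_tendstoD)
    then show "\<forall>\<^sub>F k in sequentially. (T ^^ k) J $ i < r"
    proof eventually_elim
      case (elim k)
      have "(T ^^ k) J $ i \<le> (Tp \<mu> ^^ k) J $ i"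
        using upper[OF \<mu>(1), of k] by (simp add: less_eq_vec_def)
      then show ?case
        using elim by (rule le_less_trans)
    qed
  qed
qed

lemma optimal_contractive_iff:
  assumes \<mu>: "\<mu> \<in> contractive"
  shows "cost \<mu> = Jhat \<longleftrightarrow> Tp \<mu> Jhat = T Jhat"
proof
  assume "cost \<mu> = Jhat"
  then show "Tp \<mu> Jhat = T Jhat"
    using contractive_cost_fixed_point[OF \<mu>] T_Jhat by simp
next
  assume "Tp \<mu> Jhat = T Jhat"
  then have "Tp \<mu> Jhat \<le> Jhat"
    by (simp add: T_Jhat)
  then have "cost \<mu> \<le> Jhat"
    by (rule contractive_cost_le[OF \<mu> Jhat_finite])
  then show "cost \<mu> = Jhat"
    using Jhat_le_cost[OF \<mu>] by (rule antisym)
qed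

end

theorem proposition6:
  fixes U :: "'n::finite \<Rightarrow> 'u::metric_space set"
    and b :: "'n \<Rightarrow> 'u \<Rightarrow> real"
    and A :: "'n \<Rightarrow> 'n \<Rightarrow> 'u \<Rightarrow> real"
    and Jbar :: "ennreal ^ 'n"
  assumes U_nonempty: "\<And>i. U i \<noteq> {}"
    and b_nonneg: "\<And>i u. u \<in> U i \<Longrightarrow> 0 \<le> b i u"
    and A_nonneg: "\<And>i j u. u \<in> U i \<Longrightarrow> 0 \<le> A i j u"
    and Jbar: "Jbar \<in> finite_vecs"
    and contractive_exists: "contractive_policies U A \<noteq> {}"
    and A_cont: "\<And>i j. continuous_on (U i) (A i j)"
    and b_cont: "\<And>i. continuous_on (U i) (b i)"
    and level_compact: "\<And>i (c::real) (J :: real ^ 'n). (\<And>j. 0 \<le> J $ j) \<Longrightarrow>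
          compact {u \<in> U i. b i u + (\<Sum>j\<in>UNIV. A i j u * J $ j) \<le> c}"
  shows "let Jhat = contractive_opt_cost U b A Jbar in
           (Jhat \<in> finite_vecs \<and> T_opt U b A Jhat = Jhat \<and>
             (\<forall>J' \<in> finite_vecs. T_opt U b A J' = J' \<longrightarrow> J' \<le> Jhat)) \<and>
           (\<forall>J \<in> finite_vecs. Jhat \<le> J \<longrightarrow> (\<lambda>k. (T_opt U b A ^^ k) J) \<longlonglongrightarrow> Jhat) \<and>
           (\<forall>\<mu> \<in> contractive_policies U A.
             policy_cost b A Jbar \<mu> = Jhat \<longleftrightarrow> T_pol b A \<mu> Jhat = T_opt U b A Jhat)"
proof -
  interpret affine_monotonic U b A Jbar
    by unfold_locales (use U_nonempty b_nonneg A_nonneg Jbar contractive_exists in auto)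
  show ?thesis
    unfolding Let_def
  proof (intro conjI ballI impI)
    show "J' \<le> Jhat" if "J' \<in> finite_vecs" "T J' = J'" for J'
      using that by (intro subsolution_le_Jhat) simp_all
  qed (simp_all add: Jhat_finite T_Jhat value_iteration_tendsto_Jhat optimal_contractive_iff)
qed

end
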